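(* Let $\Omega\subset\mathbb{R}^N$, $\Omega\ne\mathbb{R}^N$, be an open set with Whitney decomposition $\mathcal{W}(\Omega)$. Assume that there exist constants $C_1,C_2,C_3$ and an integer $j_0\le0$ such that for each Whitney cube $Q\in\mathcal{W}_k(\Omega)$ with $k<j_0$ and for each $j$ such that $k<j\le j_0$ there exists a Whitney cube $E(Q,j)\in\mathcal{W}(\Omega)$ with the following properties: (i) $C_12^j\le\ell(E(Q,j))\le C_22^j$; (ii) $|x-y|<C_32^j$ for all $x\in Q$ and $y\in E(Q,j)$. Additionally, assume that: (iii) there exist constants $\lambda<N$ and $C_4$ such that for each cube $Q_0\in\mathcal{W}_n(\Omega)$, $n\in\mathbb{Z}$, $$\#\{(Q,j): Q\in\mathcal{W}_m(\Omega)\text{ and }E(Q,j)=Q_0\}\le C_4\,2^{\lambda(n-m)}\quad\text{for all }m\in\mathbb{Z}.$$ Let $0<p<\infty$. Then there is $c=c(C_1,C_2,C_3,C_4,j_0,\lambda,p)>0$ such that for every $u\in L^p(\Omega)$ $$\int_\Omega|u(x)|^p\,\ln^+\!\left(\frac1{\delta_x}\right)dx\le c\left(\ \iint_{\substack{\Omega\times\Omega\\|x-y|<1}}\frac{|u(x)-u(y)|^p}{|x-y|^N}\,dy\,dx+\int_\Omega|u(x)|^p\,dx\right).$$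
   Context: The dimension $N\ge1$ is fixed and $\Omega$ is nonempty. $\ln^+(t)=\max\{\ln t,0\}$, $\delta_x=\mathrm{dist}(x,\partial\Omega)$. The constants $C_1,\dots,C_4$ are positive real numbers. A (closed) cube in $\mathbb{R}^N$ is dyadic if its side length is $2^m$ for some $m\in\mathbb{Z}$ and all coordinates of its vertices are integer multiples of $2^m$; $\ell(Q)$ is the side length of $Q$. A Whitney decomposition $\mathcal{W}(\Omega)$ is a family of dyadic cubes with pairwise disjoint interiors, whose union is $\Omega$, such that $\mathrm{diam}(Q)\le\mathrm{dist}(Q,\partial\Omega)\le4\,\mathrm{diam}(Q)$ for every $Q\in\mathcal{W}(\Omega)$. $\mathcal{W}_m(\Omega)=\{Q\in\mathcal{W}(\Omega):\ell(Q)=2^m\}$. In (iii), $(Q,j)$ ranges over those pairs for which $E(Q,j)$ is defined, i.e. $Q\in\mathcal{W}_m(\Omega)$ and $m<j\le j_0$. *)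

theory Defs
  imports "HOL-Analysis.Analysis"
begin

text \<open>Closed cubes are taken with edges parallel to the coordinate axes; for cubes satisfying
  the dyadic vertex condition this is automatic.\<close>

definition is_cube :: "real \<Rightarrow> (real ^ 'n) set \<Rightarrow> bool" where
  "is_cube l Q \<longleftrightarrow> 0 < l \<and> (\<exists>a b. Q = cbox a b \<and> (\<forall>i. b $ i - a $ i = l))"

definition side_length :: "(real ^ 'n) set \<Rightarrow> real" where
  "side_length Q = (THE l. is_cube l Q)"

lemma side_length_eq:
  assumes "is_cube l Q"
  shows "side_length Q = l"
proof -
  have "l' = l" if l': "is_cube l' Q" for l'
  proof -
    obtain a b where ab: "0 < l" "Q = cbox a b" "\<And>i. b $ i - a $ i = l"
      using assms unfolding is_cube_def by blast
    obtain a' b' where ab': "Q = cbox a' b'" "\<And>i. b' $ i - a' $ i = l'"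
      using l' unfolding is_cube_def by blast
    have "\<forall>i. a $ i \<le> b $ i"
      using ab(1,3) by (metis diff_gt_0_iff_gt less_imp_le)
    then have "a \<in> cbox a b"
      by (simp add: mem_box_cart)
    then have "cbox a b \<noteq> {}"
      by blast
    then have "a = a' \<and> b = b'"
      using ab(2) ab'(1) eq_cbox by blast
    then show ?thesis
      using ab(3) ab'(2) by metis
  qed
  then show ?thesis
    unfolding side_length_def using assms by blast
qed

text \<open>The coordinates of the vertices of \<open>cbox a b\<close> are the numbers \<open>a $ i\<close> and \<open>b $ i\<close>.\<close>

definition dyadic_cube :: "(real ^ 'n) set \<Rightarrow> bool" where
  "dyadic_cube Q \<longleftrightarrow>
     (\<exists>(m::int) a b. Q = cbox a b \<and>
        (\<forall>i. b $ i - a $ i = 2 powi m \<and>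
             (\<exists>k::int. a $ i = of_int k * 2 powi m) \<and>
             (\<exists>k::int. b $ i = of_int k * 2 powi m)))"

definition whitney_decomposition :: "(real ^ 'n) set \<Rightarrow> (real ^ 'n) set set \<Rightarrow> bool" where
  "whitney_decomposition \<Omega> W \<longleftrightarrow>
     (\<forall>Q\<in>W. dyadic_cube Q) \<and>
     pairwise (\<lambda>Q R. interior Q \<inter> interior R = {}) W \<and>
     \<Union>W = \<Omega> \<and>
     (\<forall>Q\<in>W. diameter Q \<le> setdist Q (frontier \<Omega>) \<and>
             setdist Q (frontier \<Omega>) \<le> 4 * diameter Q)"

definition whitney_level :: "(real ^ 'n) set set \<Rightarrow> int \<Rightarrow> (real ^ 'n) set set" where
  "whitney_level W m = {Q \<in> W. side_length Q = 2 powi m}"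

definition ln_plus :: "real \<Rightarrow> real" where
  "ln_plus t = max (ln t) 0"

definition Lp_on :: "real \<Rightarrow> (real ^ 'n) set \<Rightarrow> (real ^ 'n \<Rightarrow> real) set" where
  "Lp_on p \<Omega> = {u. u \<in> borel_measurable (lebesgue_on \<Omega>) \<and>
                   integrable (lebesgue_on \<Omega>) (\<lambda>x. \<bar>u x\<bar> powr p)}"

end

theory Submission
  imports Defs
begin

text \<open>
  Every point of a Whitney cube \<open>Q\<close> of side \<open>2\<^sup>k\<close> has distance at least \<open>2\<^sup>k\<close> from the boundary,
  so on \<open>Q\<close> the logarithmic weight is at most \<open>ln 2 * (- k)\<^sup>+\<close>: up to a bounded number, it counts the dyadic
  scales \<open>j\<close> with \<open>k < j \<le> j1\<close>, where \<open>j1\<close> is a fixed integer (lemma \<open>ln_plus_inverse_dist_le\<close>).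
  Hence \<open>\<bar>u x\<bar> powr p\<close> times the weight is bounded by a multiple of \<open>\<bar>u x\<bar> powr p\<close> plus one copy of it for each such
  scale, and the copy of scale \<open>j\<close> is compared with the values of \<open>u\<close> on the cube \<open>E Q j\<close> of size comparable to \<open>2\<^sup>j\<close>
  (lemma \<open>pointwise_le_average\<close>). This leaves two kinds of terms.

  The differences \<open>\<bar>u x - u y\<bar> powr p\<close> averaged over \<open>y \<in> E Q j\<close>: there \<open>\<bar>x - y\<bar> < C3 * 2\<^sup>j\<close> while the side of \<open>E Q j\<close>
  is at least \<open>C1 * 2\<^sup>j\<close>, so the average is dominated by the singular integral over \<open>E Q j\<close>. For fixed \<open>Q\<close>
  each cube occurs as \<open>E Q j\<close> for a bounded number of scales only, because its side determines \<open>2\<^sup>j\<close> up to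
  the factor \<open>C2 / C1\<close>; so the sum over \<open>j\<close> is at most a constant times the integral over all of \<open>\<Omega>\<close>
  (lemma \<open>sum_integrals_scales_le\<close>). Taking \<open>j1\<close> so small that \<open>C3 * 2\<^sup>j\<^sup>1 \<le> 1\<close> confines this to \<open>\<bar>x - y\<bar> < 1\<close>.

  The averages of \<open>\<bar>u\<bar> powr p\<close> over \<open>E Q j\<close>: these are constant in \<open>x \<in> Q\<close>, so integrating over \<open>Q\<close> multiplies
  them by the volume of \<open>Q\<close>. Regrouping all pairs \<open>(Q, j)\<close> according to the cube \<open>Q0 = E Q j\<close> of side \<open>2\<^sup>n\<close> and the
  level \<open>m\<close> of \<open>Q\<close>, a term carries the factor \<open>2 powr (N * (m - n))\<close>, and there are at most \<open>C4 * 2 powr (lam * (n - m))\<close>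
  of them. Since \<open>lam < N\<close>, and \<open>m - n\<close> is bounded above by a constant, the sum over \<open>m\<close> is a convergent
  geometric series (lemma \<open>sum_averages_le\<close>), and the integrals over the cubes \<open>Q0\<close> add up to at most the integral over \<open>\<Omega>\<close>.

  The double integral is not reordered at any point: the first kind of terms is estimated for each
  \<open>x\<close> separately, and only the second kind is summed over all of the cubes.
\<close>

section \<open>Dyadic cubes\<close>

text \<open>For a dyadic cube the logarithm is already an integer; rounding only makes the level an \<open>int\<close>, so that cubes can be grouped by it.\<close>

definition level :: "(real ^ 'n) set \<Rightarrow> int" where
  "level Q = \<lfloor>log 2 (side_length Q)\<rfloor>"

lemma level_eq: "side_length Q = 2 powi m \<Longrightarrow> level Q = m"
  unfolding level_def by (simp add: powr_real_of_int'[symmetric])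

lemma dyadic_cube_is_cube:
  assumes "dyadic_cube Q"
  shows "is_cube (2 powi level Q) Q"
proof -
  obtain m :: int and a b where Q: "Q = cbox a b" "\<forall>i. b $ i - a $ i = 2 powi m"
    using assms unfolding dyadic_cube_def by blast
  have c: "is_cube (2 powi m) Q"
    unfolding is_cube_def using Q by auto
  then have "level Q = m"
    by (intro level_eq side_length_eq)
  with c show ?thesis by simp
qed

lemma cube_cbox:
  assumes "is_cube l Q"
  obtains a b where "Q = cbox a b" "\<And>i. b $ i - a $ i = l" "l > 0"
  using assms unfolding is_cube_def by blast

lemma emeasure_cube:
  fixes Q :: "(real ^ 'n) set"
  assumes "is_cube l Q"
  shows "emeasure lebesgue Q = ennreal (l ^ CARD('n))"
proof -
  obtain a b where Q: "Q = cbox a b" "\<And>i. b $ i - a $ i = l" "l > 0"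
    using cube_cbox[OF assms] by metis
  have le: "a $ i \<le> b $ i" for i
    using Q(2)[of i] Q(3) by linarith
  then have "cbox a b \<noteq> {}"
    by (metis interval_ne_empty_cart(1))
  then have "measure lborel (cbox a b) = (\<Prod>i\<in>UNIV. b $ i - a $ i)"
    by (rule content_cbox_cart)
  then have "measure lborel Q = l ^ CARD('n)"
    using Q by simp
  then show ?thesis
    using Q(1) by (simp add: emeasure_eq_ennreal_measure emeasure_lborel_cbox_eq)
qed

lemma cube_interior:
  assumes "is_cube l Q"
  shows "interior Q \<noteq> {}" "negligible (Q - interior Q)" "Q \<in> sets lebesgue"
proof -
  obtain a b where Q: "Q = cbox a b" "\<And>i. b $ i - a $ i = l" "l > 0"
    using cube_cbox[OF assms] by metis
  have "a $ i < b $ i" for i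
    using Q(2)[of i] Q(3) by linarith
  then show "interior Q \<noteq> {}"
    using Q(1) by (simp add: interval_ne_empty_cart)
  show "negligible (Q - interior Q)" "Q \<in> sets lebesgue"
    using Q(1) by (auto simp: negligible_frontier_interval)
qed

section \<open>Counting integrals and a geometric series\<close>

text \<open>Regrouping a sum along the fibres of \<open>\<kappa>\<close>: a summand that depends on \<open>p\<close> only through \<open>\<kappa> p\<close> is
  repeated once for each point of the fibre. Both later counting arguments have this form.\<close>

lemma nn_integral_count_space_fibres:
  fixes w :: "'d \<Rightarrow> ennreal"
  shows "(\<integral>\<^sup>+p. w (\<kappa> p) \<partial>count_space P)
    = (\<integral>\<^sup>+d. emeasure (count_space UNIV) {p\<in>P. \<kappa> p = d} * w d \<partial>count_space UNIV)"
proof -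
  have "(\<integral>\<^sup>+p. w (\<kappa> p) \<partial>count_space P)
      = (\<integral>\<^sup>+p. \<integral>\<^sup>+d. indicator {p\<in>P. \<kappa> p = d} p * w d \<partial>count_space UNIV \<partial>count_space UNIV)"
  proof -
    have "(\<integral>\<^sup>+d. indicator {p\<in>P. \<kappa> p = d} p * w d \<partial>count_space UNIV) = w (\<kappa> p) * indicator P p" for p
      using nn_integral_count_space'[of "{\<kappa> p}" UNIV "\<lambda>d. indicator {p\<in>P. \<kappa> p = d} p * w d"]
      by (simp add: indicator_def mult.commute)
    then show ?thesis
      by (simp add: nn_integral_restrict_space[symmetric] restrict_count_space)
  qed
  also have "\<dots> = (\<integral>\<^sup>+d. \<integral>\<^sup>+p. indicator {p\<in>P. \<kappa> p = d} p * w d \<partial>count_space UNIV \<partial>count_space UNIV)"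
    using nn_integral_fst_count_space[of "\<lambda>(p, d). indicator {p\<in>P. \<kappa> p = d} p * w d"]
      nn_integral_snd_count_space[of "\<lambda>(p, d). indicator {p\<in>P. \<kappa> p = d} p * w d"] by simp
  also have "\<dots> = (\<integral>\<^sup>+d. emeasure (count_space UNIV) {p\<in>P. \<kappa> p = d} * w d \<partial>count_space UNIV)"
    by (simp add: nn_integral_multc)
  finally show ?thesis .
qed

lemma nn_integral_count_space_Sigma:
  fixes f :: "'a \<Rightarrow> 'b \<Rightarrow> ennreal"
  assumes "\<And>x. x \<in> A \<Longrightarrow> finite (B x)"
  shows "(\<integral>\<^sup>+x. (\<Sum>y\<in>B x. f x y) \<partial>count_space A) = (\<integral>\<^sup>+(x, y). f x y \<partial>count_space (Sigma A B))"
proof -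
  have "(\<integral>\<^sup>+x. (\<Sum>y\<in>B x. f x y) \<partial>count_space A)
      = (\<integral>\<^sup>+x. \<integral>\<^sup>+y. f x y * indicator (Sigma A B) (x, y) \<partial>count_space UNIV \<partial>count_space UNIV)"
  proof -
    have "(\<integral>\<^sup>+y. f x y * indicator (Sigma A B) (x, y) \<partial>count_space UNIV)
        = (\<Sum>y\<in>B x. f x y) * indicator A x" for x
    proof (cases "x \<in> A")
      case True
      then show ?thesis using assms[OF True]
        by (subst nn_integral_count_space'[of "B x"]) (auto split: split_indicator)
    qed (simp add: indicator_def)
    then show ?thesis
      by (simp add: nn_integral_restrict_space[symmetric] restrict_count_space)
  qed
  also have "\<dots> = (\<integral>\<^sup>+z. (case z of (x, y) \<Rightarrow> f x y * indicator (Sigma A B) (x, y)) \<partial>count_space UNIV)"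
    by (subst nn_integral_fst_count_space[symmetric]) simp
  also have "\<dots> = (\<integral>\<^sup>+(x, y). f x y \<partial>count_space (Sigma A B))"
    by (subst restrict_count_space[of UNIV, simplified, symmetric], subst nn_integral_restrict_space)
       (auto intro!: nn_integral_cong split: prod.split)
  finally show ?thesis .
qed

text \<open>The series is summed downwards from its largest index \<open>n + M\<close>.\<close>

lemma nn_integral_geometric_int:
  fixes a :: real and n M :: int
  assumes "a > 0"
  shows "(\<integral>\<^sup>+m. ennreal (2 powr (a * real_of_int (m - n))) \<partial>count_space {..n + M})
    = ennreal (2 powr (a * real_of_int M) / (1 - 2 powr (- a)))"
proof -
  have "bij_betw (\<lambda>i. n + M - int i) UNIV {..n + M}"
    by (rule bij_betwI[where g = "\<lambda>m. nat (n + M - m)"]) auto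
  from nn_integral_bij_count_space[OF this, of "\<lambda>m. ennreal (2 powr (a * real_of_int (m - n)))"]
  have "(\<integral>\<^sup>+m. ennreal (2 powr (a * real_of_int (m - n))) \<partial>count_space {..n + M})
      = (\<Sum>i. ennreal (2 powr (a * real_of_int (M - int i))))"
    by (simp add: nn_integral_count_space_nat)
  also have "\<dots> = ennreal (2 powr (a * real_of_int M) * (1 / (1 - 2 powr (- a))))"
  proof (rule suminf_ennreal_eq)
    have "2 powr (a * real_of_int (M - int i)) = 2 powr (a * real_of_int M) * (2 powr (- a)) ^ i" for i
      by (simp add: powr_realpow[symmetric] powr_powr powr_add[symmetric] algebra_simps)
    moreover have "(\<lambda>i. 2 powr (a * real_of_int M) * (2 powr (- a)) ^ i) sums
        (2 powr (a * real_of_int M) * (1 / (1 - 2 powr (- a))))"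
      using assms by (intro sums_mult geometric_sums) (simp add: powr_less_one)
    ultimately show "(\<lambda>i. 2 powr (a * real_of_int (M - int i))) sums
        (2 powr (a * real_of_int M) * (1 / (1 - 2 powr (- a))))"
      by simp
  qed auto
  finally show ?thesis by simp
qed

section \<open>Whitney families\<close>

lemma whitney_countable:
  fixes W :: "(real ^ 'n) set set"
  assumes "whitney_decomposition \<Omega> W"
  shows "countable W"
proof -
  have int: "interior Q \<noteq> {}" if "Q \<in> W" for Q
    using that assms cube_interior(1)[OF dyadic_cube_is_cube] unfolding whitney_decomposition_def by blast
  have dis: "interior Q \<inter> interior R = {}" if "Q \<in> W" "R \<in> W" "Q \<noteq> R" for Q R
    using that assms unfolding whitney_decomposition_def pairwise_def by blast
  have "inj_on interior W"
    using int dis by (metis inf.idem inj_onI)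
  moreover have "countable (interior ` W)"
    using dis by (intro countable_disjoint_open_subsets) (auto simp: pairwise_def disjnt_def)
  ultimately show ?thesis
    by (rule countable_image_inj_on[rotated])
qed

text \<open>The cubes overlap only on their boundaries, which are null sets, so they may be replaced by their
  interiors, whose indicators sum to at most the indicator of \<open>\<Omega>\<close>.\<close>

lemma whitney_sum_integrals_le:
  fixes W :: "(real ^ 'n) set set" and g :: "real ^ 'n \<Rightarrow> ennreal"
  assumes W: "whitney_decomposition \<Omega> W" and g[measurable]: "g \<in> borel_measurable lebesgue"
  shows "(\<integral>\<^sup>+Q. (\<integral>\<^sup>+x\<in>Q. g x \<partial>lebesgue) \<partial>count_space W) \<le> (\<integral>\<^sup>+x\<in>\<Omega>. g x \<partial>lebesgue)"
proof -
  have cube: "is_cube (2 powi level Q) Q" if "Q \<in> W" for Q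
    using that W dyadic_cube_is_cube unfolding whitney_decomposition_def by blast
  have [measurable]: "interior Q \<in> sets lebesgue" for Q :: "(real ^ 'n) set"
    by simp
  have "(\<integral>\<^sup>+x\<in>Q. g x \<partial>lebesgue) = (\<integral>\<^sup>+x\<in>interior Q. g x \<partial>lebesgue)" if "Q \<in> W" for Q
  proof (rule nn_integral_cong_AE)
    have "AE x in lebesgue. x \<notin> Q - interior Q"
      using cube_interior(2)[OF cube[OF that]] by (intro AE_not_in) (simp add: negligible_iff_null_sets)
    then show "AE x in lebesgue. g x * indicator Q x = g x * indicator (interior Q) x"
      by (rule AE_mp) (use interior_subset in \<open>auto intro!: AE_I2 split: split_indicator\<close>)
  qed
  then have "(\<integral>\<^sup>+Q. (\<integral>\<^sup>+x\<in>Q. g x \<partial>lebesgue) \<partial>count_space W)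
      = (\<integral>\<^sup>+Q. (\<integral>\<^sup>+x\<in>interior Q. g x \<partial>lebesgue) \<partial>count_space W)"
    by (rule nn_integral_cong) simp
  also have "\<dots> = (\<integral>\<^sup>+x. (\<integral>\<^sup>+Q. g x * indicator (interior Q) x \<partial>count_space W) \<partial>lebesgue)"
    using whitney_countable[OF W] by (subst nn_integral_count_space_nn_integral) measurable
  also have "\<dots> \<le> (\<integral>\<^sup>+x\<in>\<Omega>. g x \<partial>lebesgue)"
  proof (rule nn_integral_mono)
    fix x
    show "(\<integral>\<^sup>+Q. g x * indicator (interior Q) x \<partial>count_space W) \<le> g x * indicator \<Omega> x"
    proof (cases "\<exists>Q\<in>W. x \<in> interior Q")
      case True
      then obtain Q where Q: "Q \<in> W" "x \<in> interior Q" by blast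
      have "g x * indicator (interior R) x = 0" if "R \<in> W" "R \<notin> {Q}" for R
      proof -
        have "interior Q \<inter> interior R = {}"
          using that Q(1) W unfolding whitney_decomposition_def pairwise_def by blast
        with Q(2) have "x \<notin> interior R" by blast
        then show ?thesis by simp
      qed
      then have "(\<integral>\<^sup>+Q. g x * indicator (interior Q) x \<partial>count_space W) = (\<Sum>Q\<in>{Q}. g x * indicator (interior Q) x)"
        using Q(1) by (intro nn_integral_count_space') simp_all
      then have "(\<integral>\<^sup>+Q. g x * indicator (interior Q) x \<partial>count_space W) = g x"
        using Q(2) by simp
      moreover have "x \<in> \<Omega>"
        using Q W interior_subset unfolding whitney_decomposition_def by blast
      ultimately show ?thesis by simp
    next
      case False
      then have "(\<integral>\<^sup>+Q. g x * indicator (interior Q) x \<partial>count_space W) = (\<integral>\<^sup>+Q. 0 \<partial>count_space W)"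
        by (intro nn_integral_cong) (auto split: split_indicator)
      then show ?thesis by simp
    qed
  qed
  finally show ?thesis .
qed

lemma sigma_finite_lebesgue: "sigma_finite_measure (lebesgue :: 'a::euclidean_space measure)"
proof
  obtain A :: "'a set set" where "countable A" "A \<subseteq> sets lborel" "\<Union>A = space lborel"
    "\<forall>a\<in>A. emeasure lborel a \<noteq> \<infinity>"
    using lborel.sigma_finite_countable by blast
  then show "\<exists>A. countable A \<and> A \<subseteq> sets (lebesgue :: 'a measure) \<and> \<Union>A = space lebesgue \<and>
      (\<forall>a\<in>A. emeasure lebesgue a \<noteq> \<infinity>)"
    by (intro exI[of _ A]) (auto simp: subset_iff)
qed

section \<open>Averaging over a cube\<close>

lemma powr_add_abs_le:
  fixes a b p :: real
  assumes "p > 0"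
  shows "\<bar>a\<bar> powr p \<le> 2 powr p * (\<bar>a - b\<bar> powr p + \<bar>b\<bar> powr p)"
proof -
  have "\<bar>a\<bar> powr p \<le> (2 * max \<bar>a - b\<bar> \<bar>b\<bar>) powr p"
    using assms by (intro powr_mono2) (auto simp: max_def abs_if)
  also have "\<dots> = 2 powr p * (max \<bar>a - b\<bar> \<bar>b\<bar>) powr p"
    by (simp add: powr_mult)
  also have "\<dots> \<le> 2 powr p * (\<bar>a - b\<bar> powr p + \<bar>b\<bar> powr p)"
    by (intro mult_left_mono) (auto simp: max_def)
  finally show ?thesis .
qed

text \<open>Two admissible scales \<open>i\<close> and \<open>j\<close> satisfy \<open>C1 * 2\<^sup>j \<le> l \<le> C2 * 2\<^sup>i\<close>, so they differ by at most
  \<open>log 2 (C2 / C1)\<close>. The absolute value keeps the bound valid when there is no admissible scale.\<close>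

lemma card_dyadic_scales_le:
  fixes C1 C2 l :: real
  assumes "C1 > 0" "C2 > 0" "finite J" and J: "\<And>j. j \<in> J \<Longrightarrow> C1 * 2 powi j \<le> l \<and> l \<le> C2 * 2 powi j"
  shows "real (card J) \<le> 1 + \<bar>log 2 (C2 / C1)\<bar>"
proof (cases "J = {}")
  case False
  have *: "real_of_int (j - i) \<le> log 2 (C2 / C1)" if "i \<in> J" "j \<in> J" for i j
  proof -
    have "C1 * 2 powi j \<le> C2 * 2 powi i"
      using J that by (meson order_trans)
    then have "2 powi (j - i) \<le> C2 / C1"
      using assms by (simp add: power_int_diff field_simps)
    then have "2 powr real_of_int (j - i) \<le> C2 / C1"
      using powr_real_of_int'[of 2 "j - i"] by simp
    then show ?thesis
      using assms by (subst le_log_iff) auto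
  qed
  have "J \<subseteq> {Min J..Max J}"
    using assms False by auto
  then have "card J \<le> card {Min J..Max J}"
    by (intro card_mono) auto
  also have "\<dots> = nat (Max J - Min J + 1)" by simp
  finally have "real (card J) \<le> real_of_int (Max J - Min J) + 1"
    using Min_le[OF assms(3) Max_in[OF assms(3) False]] by linarith
  also have "real_of_int (Max J - Min J) \<le> log 2 (C2 / C1)"
    using assms False by (intro *) auto
  finally show ?thesis by linarith
qed simp

lemma whitney_cube:
  assumes "whitney_decomposition \<Omega> W" "Q \<in> W"
  shows "is_cube (2 powi level Q) Q" "side_length Q = 2 powi level Q" "Q \<subseteq> \<Omega>" "Q \<in> sets lebesgue"
proof -
  show c: "is_cube (2 powi level Q) Q"
    using assms dyadic_cube_is_cube unfolding whitney_decomposition_def by blast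
  show "side_length Q = 2 powi level Q" by (rule side_length_eq[OF c])
  show "Q \<in> sets lebesgue" by (rule cube_interior(3)[OF c])
  show "Q \<subseteq> \<Omega>" using assms unfolding whitney_decomposition_def by blast
qed

text \<open>The diameter of a Whitney cube is at least its side and at most its distance from the boundary.\<close>

lemma ln_plus_inverse_dist_le:
  fixes \<Omega> :: "(real ^ 'n) set"
  assumes W: "whitney_decomposition \<Omega> W" and Q: "Q \<in> W" "x \<in> Q" and \<Omega>: "\<Omega> \<noteq> UNIV"
  shows "ln_plus (1 / infdist x (frontier \<Omega>)) \<le> ln 2 * max 0 (- real_of_int (level Q))"
proof -
  have c: "is_cube (2 powi level Q) Q"
    by (rule whitney_cube(1)[OF W Q(1)])
  obtain a b where ab: "Q = cbox a b" "\<forall>i. b $ i - a $ i = 2 powi level Q"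
    using c[unfolded is_cube_def] by (elim conjE exE)
  have nz: "frontier \<Omega> \<noteq> {}"
    using whitney_cube(3)[OF W Q(1)] Q(2) \<Omega> by (auto simp: frontier_eq_empty)
  have "a \<in> Q" "b \<in> Q"
    using ab Q(2) by (auto simp: mem_box_cart intro: order_trans)
  have "2 powi level Q = \<bar>(b - a) $ (undefined :: 'n)\<bar>"
    using ab(2) by simp
  also have "\<dots> \<le> norm (b - a)"
    by (rule component_le_norm_cart)
  also have "\<dots> \<le> diameter Q"
    using diameter_bounded_bound[of Q b a] \<open>a \<in> Q\<close> \<open>b \<in> Q\<close> ab(1) by (simp add: dist_norm)
  also have "\<dots> \<le> setdist Q (frontier \<Omega>)"
    using W Q unfolding whitney_decomposition_def by blast
  also have "\<dots> \<le> infdist x (frontier \<Omega>)"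
    unfolding infdist_def using nz Q(2) by (auto intro!: cINF_greatest setdist_le_dist)
  finally have *: "2 powi level Q \<le> infdist x (frontier \<Omega>)" .
  have pos: "(0::real) < 2 powi level Q" by simp
  have "ln (1 / infdist x (frontier \<Omega>)) \<le> ln (1 / 2 powi level Q)"
    using * pos by (subst ln_le_cancel_iff) (auto intro!: frac_le divide_pos_pos less_le_trans[OF pos *])
  also have "\<dots> = - real_of_int (level Q) * ln 2"
    by (simp add: powr_real_of_int'[symmetric] ln_div ln_powr)
  finally show ?thesis
    unfolding ln_plus_def by (auto simp: max_def mult.commute intro: order_trans)
qed

text \<open>Integrate \<open>\<bar>v x\<bar> powr p \<le> 2 powr p * (\<bar>v x - v y\<bar> powr p + \<bar>v y\<bar> powr p)\<close> over \<open>y \<in> E\<close>, divide by the volume of \<open>E\<close>, and insert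
  \<open>1 \<le> (r / norm (x - y)) ^ N\<close> in the first term. At \<open>y = x\<close> the singular quotient is \<open>0 / 0 = 0\<close>, in agreement with
  the vanishing of the difference.\<close>

lemma pointwise_le_average:
  fixes v :: "real ^ 'n \<Rightarrow> real" and E :: "(real ^ 'n) set"
  assumes v[measurable]: "v \<in> borel_measurable lebesgue" and "p > 0" and E: "is_cube l E"
    and r: "\<And>y. y \<in> E \<Longrightarrow> norm (x - y) < r" and "l > 0"
  shows "ennreal (\<bar>v x\<bar> powr p) \<le> ennreal (2 powr p) *
    (ennreal ((r / l) ^ CARD('n)) * (\<integral>\<^sup>+y\<in>E. ennreal (\<bar>v x - v y\<bar> powr p / norm (x - y) ^ CARD('n)) \<partial>lebesgue)
     + ennreal (1 / l ^ CARD('n)) * (\<integral>\<^sup>+y\<in>E. ennreal (\<bar>v y\<bar> powr p) \<partial>lebesgue))"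
    (is "?F \<le> _ * (_ * ?I + _ * ?J)")
proof -
  let ?N = "CARD('n)"
  let ?g = "\<lambda>y. ennreal (\<bar>v x - v y\<bar> powr p / norm (x - y) ^ ?N)"
  let ?h = "\<lambda>y. ennreal (\<bar>v y\<bar> powr p)"
  have [measurable]: "E \<in> sets lebesgue" using cube_interior(3)[OF E] .
  have [measurable]: "(\<lambda>y. y) \<in> borel_measurable (lebesgue :: (real ^ 'n) measure)"
    by (simp add: measurable_completion)
  have "E \<noteq> {}" using cube_interior(1)[OF E] by auto
  then obtain y0 where "y0 \<in> E" by blast
  then have "r > 0" using r[of y0] norm_ge_zero[of "x - y0"] by linarith
  have pt: "ennreal (\<bar>v x\<bar> powr p) \<le> ennreal (2 powr p) *
      (ennreal (r ^ ?N) * ennreal (\<bar>v x - v y\<bar> powr p / norm (x - y) ^ ?N) + ennreal (\<bar>v y\<bar> powr p))"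
    if "y \<in> E" for y
  proof -
    have "\<bar>v x - v y\<bar> powr p \<le> r ^ ?N * (\<bar>v x - v y\<bar> powr p / norm (x - y) ^ ?N)"
    proof (cases "x = y")
      case False
      have "norm (x - y) ^ ?N \<le> r ^ ?N"
        using r[OF that] by (intro power_mono) auto
      then have "norm (x - y) ^ ?N * \<bar>v x - v y\<bar> powr p \<le> r ^ ?N * \<bar>v x - v y\<bar> powr p"
        by (intro mult_right_mono) auto
      with False show ?thesis by (simp add: field_simps)
    qed (use \<open>r > 0\<close> in simp)
    then have "2 powr p * (\<bar>v x - v y\<bar> powr p + \<bar>v y\<bar> powr p) \<le>
        2 powr p * (r ^ ?N * (\<bar>v x - v y\<bar> powr p / norm (x - y) ^ ?N) + \<bar>v y\<bar> powr p)"
      by (intro mult_left_mono add_right_mono) auto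
    with powr_add_abs_le[OF \<open>p > 0\<close>, of "v x" "v y"]
    have "\<bar>v x\<bar> powr p \<le> 2 powr p * (r ^ ?N * (\<bar>v x - v y\<bar> powr p / norm (x - y) ^ ?N) + \<bar>v y\<bar> powr p)"
      by linarith
    then show ?thesis
      using \<open>r > 0\<close> by (simp add: ennreal_mult[symmetric] ennreal_plus[symmetric] del: ennreal_plus)
  qed
  have "?F * ennreal (l ^ ?N) = (\<integral>\<^sup>+y\<in>E. ?F \<partial>lebesgue)"
    by (simp add: nn_integral_cmult emeasure_cube[OF E])
  also have "\<dots> \<le> (\<integral>\<^sup>+y. ennreal (2 powr p) *
      (ennreal (r ^ ?N) * (ennreal (\<bar>v x - v y\<bar> powr p / norm (x - y) ^ ?N) * indicator E y)
        + ennreal (\<bar>v y\<bar> powr p) * indicator E y) \<partial>lebesgue)" (is "_ \<le> ?R")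
    using pt by (intro nn_integral_mono) (auto split: split_indicator)
  also have "\<dots> = ennreal (2 powr p) * (ennreal (r ^ ?N) * ?I + ?J)"
  proof -
    have "?R = ennreal (2 powr p) * (\<integral>\<^sup>+y. ennreal (r ^ ?N) * (?g y * indicator E y) + ?h y * indicator E y \<partial>lebesgue)"
      by (rule nn_integral_cmult) measurable
    also have "(\<integral>\<^sup>+y. ennreal (r ^ ?N) * (?g y * indicator E y) + ?h y * indicator E y \<partial>lebesgue)
        = (\<integral>\<^sup>+y. ennreal (r ^ ?N) * (?g y * indicator E y) \<partial>lebesgue) + ?J"
      by (rule nn_integral_add) measurable
    also have "(\<integral>\<^sup>+y. ennreal (r ^ ?N) * (?g y * indicator E y) \<partial>lebesgue) = ennreal (r ^ ?N) * ?I"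
      by (rule nn_integral_cmult) measurable
    finally show ?thesis .
  qed
  finally have "?F * ennreal (l ^ ?N) * ennreal (1 / l ^ ?N) \<le>
      ennreal (2 powr p) * (ennreal (r ^ ?N) * ?I + ?J) * ennreal (1 / l ^ ?N)"
    by (rule mult_right_mono) simp
  also have "?F * ennreal (l ^ ?N) * ennreal (1 / l ^ ?N) = ?F"
    using \<open>l > 0\<close> by (simp add: ennreal_mult[symmetric] mult.assoc)
  also have "ennreal (2 powr p) * (ennreal (r ^ ?N) * ?I + ?J) * ennreal (1 / l ^ ?N) =
      ennreal (2 powr p) * ((ennreal (r ^ ?N) * ennreal (1 / l ^ ?N)) * ?I + ennreal (1 / l ^ ?N) * ?J)"
    by (simp only: distrib_left distrib_right mult_ac)
  also have "ennreal (r ^ ?N) * ennreal (1 / l ^ ?N) = ennreal ((r / l) ^ ?N)"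
    using \<open>l > 0\<close> \<open>r > 0\<close> by (simp add: ennreal_mult[symmetric] power_divide)
  finally show ?thesis .
qed

section \<open>Bounded overlap and regrouping\<close>

text \<open>A cube of the family occurs at a bounded number of scales by \<open>card_dyadic_scales_le\<close>, and the
  cubes of the family have disjoint interiors.\<close>

lemma sum_integrals_scales_le:
  fixes W :: "(real ^ 'n) set set" and g :: "real ^ 'n \<Rightarrow> ennreal" and E :: "int \<Rightarrow> (real ^ 'n) set"
  assumes W: "whitney_decomposition \<Omega> W" and g: "g \<in> borel_measurable lebesgue"
    and "finite J" "C1 > 0" "C2 > 0"
    and E: "\<And>j. j \<in> J \<Longrightarrow> E j \<in> W \<and> C1 * 2 powi j \<le> side_length (E j) \<and> side_length (E j) \<le> C2 * 2 powi j"
  shows "(\<Sum>j\<in>J. \<integral>\<^sup>+y\<in>E j. g y \<partial>lebesgue)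
    \<le> ennreal (1 + \<bar>log 2 (C2 / C1)\<bar>) * (\<integral>\<^sup>+y\<in>\<Omega>. g y \<partial>lebesgue)"
proof -
  let ?K = "1 + \<bar>log 2 (C2 / C1)\<bar>"
  let ?\<phi> = "\<lambda>Q. \<integral>\<^sup>+y\<in>Q. g y \<partial>lebesgue"
  have "(\<Sum>j\<in>J. ?\<phi> (E j)) = (\<integral>\<^sup>+j. ?\<phi> (E j) \<partial>count_space J)"
    using \<open>finite J\<close> by (simp add: nn_integral_count_space_finite)
  also have "\<dots> = (\<integral>\<^sup>+Q. emeasure (count_space UNIV) {j\<in>J. E j = Q} * ?\<phi> Q \<partial>count_space UNIV)"
    by (rule nn_integral_count_space_fibres)
  also have "\<dots> \<le> (\<integral>\<^sup>+Q. ennreal ?K * ?\<phi> Q * indicator W Q \<partial>count_space UNIV)"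
  proof (rule nn_integral_mono)
    fix Q
    have fin: "finite {j\<in>J. E j = Q}" using \<open>finite J\<close> by simp
    have "real (card {j\<in>J. E j = Q}) \<le> ?K"
      using E by (intro card_dyadic_scales_le[OF \<open>C1 > 0\<close> \<open>C2 > 0\<close> fin, of "side_length Q"]) blast
    then have "emeasure (count_space UNIV) {j\<in>J. E j = Q} \<le> ennreal ?K"
      using fin by (simp add: emeasure_count_space_finite ennreal_of_nat_eq_real_of_nat ennreal_leI del: ennreal_plus)
    moreover have "{j\<in>J. E j = Q} = {}" if "Q \<notin> W"
      using that E by blast
    ultimately show "emeasure (count_space UNIV) {j\<in>J. E j = Q} * ?\<phi> Q \<le> ennreal ?K * ?\<phi> Q * indicator W Q"
      by (cases "Q \<in> W") (simp_all add: mult_right_mono del: ennreal_plus Collect_empty_eq)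
  qed
  also have "\<dots> = (\<integral>\<^sup>+Q. ennreal ?K * ?\<phi> Q \<partial>count_space W)"
    by (simp add: nn_integral_restrict_space[symmetric] restrict_count_space)
  also have "\<dots> = ennreal ?K * (\<integral>\<^sup>+Q. ?\<phi> Q \<partial>count_space W)"
    by (rule nn_integral_cmult) simp
  also have "\<dots> \<le> ennreal ?K * (\<integral>\<^sup>+y\<in>\<Omega>. g y \<partial>lebesgue)"
    by (intro mult_left_mono whitney_sum_integrals_le[OF W g]) simp
  finally show ?thesis .
qed

text \<open>With \<open>Q0 = E Q j\<close>, \<open>n\<close> the level of \<open>Q0\<close> and \<open>m\<close> the level of \<open>Q\<close>, the summand is \<open>2 powr (N * (m - n))\<close> times the
  integral of \<open>F\<close> over \<open>Q0\<close>. Against the number of pairs \<open>(Q, j)\<close> with given \<open>Q0\<close> and \<open>m\<close>, this leaves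
  \<open>2 powr ((N - lam) * (m - n))\<close>. Since \<open>C1 * 2\<^sup>m \<le> C1 * 2\<^sup>j \<le> 2\<^sup>n\<close>, only levels with \<open>m - n \<le> - log 2 C1\<close> contribute,
  so the sum over \<open>m\<close> is a geometric series.\<close>

lemma sum_averages_le:
  fixes W :: "(real ^ 'n) set set" and F :: "real ^ 'n \<Rightarrow> ennreal" and E :: "(real ^ 'n) set \<Rightarrow> int \<Rightarrow> (real ^ 'n) set"
  assumes W: "whitney_decomposition \<Omega> W" and F: "F \<in> borel_measurable lebesgue"
    and "C1 > 0" "C4 > 0" and lam: "lam < real CARD('n)" and "j1 \<le> j0"
    and E: "\<And>Q j. Q \<in> W \<Longrightarrow> level Q < j \<Longrightarrow> j \<le> j1 \<Longrightarrow> E Q j \<in> W \<and> C1 * 2 powi j \<le> side_length (E Q j)"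
    and fin: "\<And>n Q0 m. Q0 \<in> whitney_level W n \<Longrightarrow>
       finite {(Q, j). Q \<in> whitney_level W m \<and> m < j \<and> j \<le> j0 \<and> E Q j = Q0}"
    and card: "\<And>n Q0 m. Q0 \<in> whitney_level W n \<Longrightarrow>
       real (card {(Q, j). Q \<in> whitney_level W m \<and> m < j \<and> j \<le> j0 \<and> E Q j = Q0})
         \<le> C4 * 2 powr (lam * real_of_int (n - m))"
  shows "(\<integral>\<^sup>+Q. (\<Sum>j\<in>{level Q<..j1}. emeasure lebesgue Q *
      (ennreal (1 / side_length (E Q j) ^ CARD('n)) * (\<integral>\<^sup>+y\<in>E Q j. F y \<partial>lebesgue))) \<partial>count_space W)
    \<le> ennreal (C4 * (2 powr ((real CARD('n) - lam) * real_of_int \<lceil>- log 2 C1\<rceil>) / (1 - 2 powr (lam - real CARD('n)))))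
       * (\<integral>\<^sup>+y\<in>\<Omega>. F y \<partial>lebesgue)"
proof -
  let ?N = "CARD('n)"
  define a where "a = real ?N - lam"
  define M where "M = \<lceil>- log 2 C1\<rceil>"
  have "a > 0" using lam by (simp add: a_def)
  define S where "S = 2 powr (a * real_of_int M) / (1 - 2 powr (- a))"
  have "S \<ge> 0"
    using \<open>a > 0\<close> by (auto simp: S_def powr_less_one less_imp_le intro!: divide_nonneg_nonneg)
  let ?\<phi> = "\<lambda>Q. \<integral>\<^sup>+y\<in>Q. F y \<partial>lebesgue"
  define P where "P = (SIGMA Q:W. {level Q<..j1})"
  define \<kappa> where "\<kappa> = (\<lambda>(Q, j). (E Q j, level Q))"
  \<comment> \<open>The volume of \<open>Q\<close> divided by that of \<open>Q0\<close> is \<open>2 powr (N * (m - level Q0))\<close>.\<close>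
  define w where "w = (\<lambda>(Q0, m). ennreal (2 powr (real ?N * real_of_int (m - level Q0))) * ?\<phi> Q0)"
  have weight: "emeasure lebesgue Q * (ennreal (1 / side_length (E Q j) ^ ?N) * ?\<phi> (E Q j)) = w (\<kappa> (Q, j))"
    if "(Q, j) \<in> P" for Q j
  proof -
    have Q: "Q \<in> W" and E': "E Q j \<in> W"
      using that E unfolding P_def by auto
    have "emeasure lebesgue Q * ennreal (1 / side_length (E Q j) ^ ?N)
        = ennreal ((2 powi level Q / 2 powi level (E Q j)) ^ ?N)"
      unfolding emeasure_cube[OF whitney_cube(1)[OF W Q]] whitney_cube(2)[OF W E']
      by (simp add: ennreal_mult[symmetric] power_divide)
    also have "(2 powi level Q / 2 powi level (E Q j) :: real) = 2 powr real_of_int (level Q - level (E Q j))"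
      by (simp add: powr_real_of_int'[symmetric] powr_diff)
    also have "\<dots> ^ ?N = 2 powr (real ?N * real_of_int (level Q - level (E Q j)))"
      by (simp add: powr_realpow[symmetric] powr_powr mult.commute)
    finally show ?thesis
      by (simp only: w_def \<kappa>_def prod.case mult.assoc[symmetric])
  qed
  have fibre: "emeasure (count_space UNIV) {p\<in>P. \<kappa> p = (Q0, m)} * w (Q0, m)
      \<le> ?\<phi> Q0 * indicator W Q0 * (ennreal C4 *
          (ennreal (2 powr (a * real_of_int (m - level Q0))) * indicator {..level Q0 + M} m))" for Q0 :: "(real ^ 'n) set" and m
  proof (cases "{p\<in>P. \<kappa> p = (Q0, m)} = {}")
    case True
    then show ?thesis by (metis (no_types, lifting) emeasure_empty mult_zero_left zero_le)
  next
    case False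
    then obtain Q j where Qj: "(Q, j) \<in> P" "E Q j = Q0" "level Q = m"
      unfolding \<kappa>_def by auto
    then have *: "Q \<in> W" "m < j" "j \<le> j1" unfolding P_def by auto
    have Q0: "Q0 \<in> W" "C1 * 2 powi j \<le> 2 powi level Q0"
      using E[of Q j] * Qj whitney_cube(2)[OF W] by auto
    then have lev: "Q0 \<in> whitney_level W (level Q0)"
      unfolding whitney_level_def using whitney_cube(2)[OF W] by auto
    have "m \<le> level Q0 + M"
    proof -
      have "C1 \<le> 2 powi (level Q0 - j)"
        using Q0(2) by (simp add: power_int_diff field_simps)
      then have "C1 \<le> 2 powr real_of_int (level Q0 - j)"
        using powr_real_of_int'[of 2 "level Q0 - j"] by simp
      then have "log 2 C1 \<le> real_of_int (level Q0 - j)"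
        using \<open>C1 > 0\<close> by (subst log_le_iff) auto
      then show ?thesis using *(2) unfolding M_def by linarith
    qed
    let ?S = "{(Q, j). Q \<in> whitney_level W m \<and> m < j \<and> j \<le> j0 \<and> E Q j = Q0}"
    have "{p\<in>P. \<kappa> p = (Q0, m)} \<subseteq> ?S"
      using \<open>j1 \<le> j0\<close> whitney_cube(2)[OF W] unfolding P_def \<kappa>_def whitney_level_def by auto
    then have "emeasure (count_space UNIV) {p\<in>P. \<kappa> p = (Q0, m)} \<le> emeasure (count_space UNIV) ?S"
      by (intro emeasure_mono) auto
    also have "\<dots> = ennreal (real (card ?S))"
      using fin[OF lev, of m] by (simp add: emeasure_count_space_finite ennreal_of_nat_eq_real_of_nat)
    also have "\<dots> \<le> ennreal (C4 * 2 powr (lam * real_of_int (level Q0 - m)))"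
      by (intro ennreal_leI card[OF lev])
    finally have "emeasure (count_space UNIV) {p\<in>P. \<kappa> p = (Q0, m)} * w (Q0, m) \<le>
        ennreal (C4 * 2 powr (lam * real_of_int (level Q0 - m))) * w (Q0, m)"
      by (rule mult_right_mono) simp
    also have "\<dots> = ?\<phi> Q0 * (ennreal (C4 * (2 powr (lam * real_of_int (level Q0 - m)) * 2 powr (real ?N * real_of_int (m - level Q0)))))"
      using \<open>C4 > 0\<close> by (simp add: w_def ennreal_mult mult_ac)
    also have "2 powr (lam * real_of_int (level Q0 - m)) * 2 powr (real ?N * real_of_int (m - level Q0))
        = 2 powr (a * real_of_int (m - level Q0))"
      by (simp add: powr_add[symmetric] a_def algebra_simps)
    finally show ?thesis
      using Q0(1) \<open>m \<le> level Q0 + M\<close> \<open>C4 > 0\<close> by (simp add: ennreal_mult)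
  qed
  have "(\<integral>\<^sup>+Q. (\<Sum>j\<in>{level Q<..j1}. emeasure lebesgue Q *
      (ennreal (1 / side_length (E Q j) ^ ?N) * ?\<phi> (E Q j))) \<partial>count_space W)
    = (\<integral>\<^sup>+(Q, j). emeasure lebesgue Q * (ennreal (1 / side_length (E Q j) ^ ?N) * ?\<phi> (E Q j)) \<partial>count_space P)"
    unfolding P_def by (rule nn_integral_count_space_Sigma) simp
  also have "\<dots> = (\<integral>\<^sup>+z. w (\<kappa> z) \<partial>count_space P)"
    by (intro nn_integral_cong) (use weight in auto)
  also have "\<dots> = (\<integral>\<^sup>+d. emeasure (count_space UNIV) {p\<in>P. \<kappa> p = d} * w d \<partial>count_space UNIV)"
    by (rule nn_integral_count_space_fibres)
  also have "\<dots> = (\<integral>\<^sup>+Q0. \<integral>\<^sup>+m. emeasure (count_space UNIV) {p\<in>P. \<kappa> p = (Q0, m)} * w (Q0, m)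
      \<partial>count_space UNIV \<partial>count_space UNIV)"
    by (rule nn_integral_fst_count_space[symmetric])
  also have "\<dots> \<le> (\<integral>\<^sup>+Q0. \<integral>\<^sup>+m. ?\<phi> Q0 * indicator W Q0 * (ennreal C4 *
          (ennreal (2 powr (a * real_of_int (m - level Q0))) * indicator {..level Q0 + M} m))
      \<partial>count_space UNIV \<partial>count_space UNIV)"
    by (intro nn_integral_mono fibre)
  also have "\<dots> = (\<integral>\<^sup>+Q0. ?\<phi> Q0 * indicator W Q0 * (ennreal C4 * ennreal S) \<partial>count_space UNIV)"
  proof (rule nn_integral_cong)
    fix Q0 :: "(real ^ 'n) set"
    have "(\<integral>\<^sup>+m. ennreal (2 powr (a * real_of_int (m - level Q0))) * indicator {..level Q0 + M} m \<partial>count_space UNIV) = ennreal S"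
      using nn_integral_geometric_int[OF \<open>a > 0\<close>, of "level Q0" M]
      by (simp add: S_def nn_integral_restrict_space[symmetric] restrict_count_space)
    then show "(\<integral>\<^sup>+m. ?\<phi> Q0 * indicator W Q0 * (ennreal C4 *
          (ennreal (2 powr (a * real_of_int (m - level Q0))) * indicator {..level Q0 + M} m)) \<partial>count_space UNIV)
        = ?\<phi> Q0 * indicator W Q0 * (ennreal C4 * ennreal S)"
      by (simp add: nn_integral_cmult)
  qed
  also have "\<dots> = (\<integral>\<^sup>+Q0. ?\<phi> Q0 * indicator W Q0 \<partial>count_space UNIV) * (ennreal C4 * ennreal S)"
    by (rule nn_integral_multc) simp
  also have "\<dots> = (\<integral>\<^sup>+Q0. ?\<phi> Q0 \<partial>count_space W) * (ennreal C4 * ennreal S)"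
    by (simp add: nn_integral_restrict_space[symmetric] restrict_count_space)
  also have "\<dots> \<le> (\<integral>\<^sup>+y\<in>\<Omega>. F y \<partial>lebesgue) * (ennreal C4 * ennreal S)"
    by (intro mult_right_mono whitney_sum_integrals_le[OF W F]) simp
  also have "\<dots> = ennreal (C4 * S) * (\<integral>\<^sup>+y\<in>\<Omega>. F y \<partial>lebesgue)"
    using \<open>C4 > 0\<close> \<open>S \<ge> 0\<close> by (simp add: ennreal_mult mult_ac)
  finally show ?thesis
    by (simp add: S_def a_def M_def)
qed

section \<open>The weighted estimate\<close>

text \<open>The inner integral of the truncated Gagliardo seminorm of smoothness zero, whose kernel is \<open>norm (x - y)\<close> to the
  power \<open>- N\<close>.\<close>

definition gagliardo :: "real \<Rightarrow> (real ^ 'n) set \<Rightarrow> (real ^ 'n \<Rightarrow> real) \<Rightarrow> real ^ 'n \<Rightarrow> ennreal" where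
  "gagliardo p \<Omega> v x = (\<integral>\<^sup>+y\<in>{y\<in>\<Omega>. norm (x - y) < 1}.
     ennreal (\<bar>v x - v y\<bar> powr p / norm (x - y) ^ CARD('n)) \<partial>lebesgue)"

text \<open>This is what makes the outer integral additive in the final estimate.\<close>

lemma measurable_gagliardo:
  fixes v :: "real ^ 'n \<Rightarrow> real"
  assumes [measurable]: "v \<in> borel_measurable lebesgue" and "open \<Omega>"
  shows "gagliardo p \<Omega> v \<in> borel_measurable lebesgue"
proof -
  interpret sigma_finite_measure "lebesgue :: (real ^ 'n) measure"
    by (rule sigma_finite_lebesgue)
  have [measurable]: "\<Omega> \<in> sets lebesgue" using \<open>open \<Omega>\<close> by simp
  have [measurable]: "(\<lambda>y. y) \<in> borel_measurable (lebesgue :: (real ^ 'n) measure)"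
    by (simp add: measurable_completion)
  have "gagliardo p \<Omega> v = (\<lambda>x. \<integral>\<^sup>+y. ennreal (\<bar>v x - v y\<bar> powr p / norm (x - y) ^ CARD('n)) *
      (if norm (x - y) < 1 then indicator \<Omega> y else 0) \<partial>lebesgue)"
    unfolding gagliardo_def by (intro ext nn_integral_cong) (auto split: split_indicator)
  also have "\<dots> \<in> borel_measurable lebesgue"
    by measurable
  finally show ?thesis .
qed

text \<open>The estimate at a single point \<open>x\<close> of a cube of level \<open>k\<close>, before integration in \<open>x\<close>. Since
  \<open>(- k)\<^sup>+\<close> is at most \<open>- j1\<close> plus the number of scales \<open>j\<close> with \<open>k < j \<le> j1\<close>, each of these scales
  contributes one application of \<open>pointwise_le_average\<close>. The differences are then summed with bounded overlap,
  while the averages of \<open>\<bar>v\<bar> powr p\<close> are kept, as they can be summed only after integration over all cubes.\<close>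

lemma scale_sum_estimate:
  fixes v :: "real ^ 'n \<Rightarrow> real" and E :: "int \<Rightarrow> (real ^ 'n) set"
  assumes W: "whitney_decomposition \<Omega> W" and v[measurable]: "v \<in> borel_measurable lebesgue"
    and "open \<Omega>" "p > 0" "C1 > 0" "C2 > 0" "C3 > 0" "j1 \<le> 0"
    and C3: "C3 * 2 powi j1 \<le> 1"
    and E: "\<And>j. k < j \<Longrightarrow> j \<le> j1 \<Longrightarrow> E j \<in> W \<and> C1 * 2 powi j \<le> side_length (E j) \<and>
      side_length (E j) \<le> C2 * 2 powi j \<and> (\<forall>y\<in>E j. norm (x - y) < C3 * 2 powi j)"
  shows "ennreal (\<bar>v x\<bar> powr p) * ennreal (max 0 (- real_of_int k)) \<le>
    ennreal (- real_of_int j1) * ennreal (\<bar>v x\<bar> powr p) + ennreal (2 powr p) *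
      (ennreal ((C3 / C1) ^ CARD('n) * (1 + \<bar>log 2 (C2 / C1)\<bar>)) * gagliardo p \<Omega> v x
       + (\<Sum>j\<in>{k<..j1}. ennreal (1 / side_length (E j) ^ CARD('n)) * (\<integral>\<^sup>+y\<in>E j. ennreal (\<bar>v y\<bar> powr p) \<partial>lebesgue)))"
    (is "?F * _ \<le> _ * ?F + _ * (ennreal (?c * ?K) * ?G + (\<Sum>j\<in>_. ?A j))")
proof -
  let ?N = "CARD('n)"
  have [measurable]: "\<Omega> \<in> sets lebesgue" using \<open>open \<Omega>\<close> by simp
  have [measurable]: "(\<lambda>y. y) \<in> borel_measurable (lebesgue :: (real ^ 'n) measure)"
    by (simp add: measurable_completion)
  \<comment> \<open>The indicator of the unit ball is put into the integrand; it equals 1 on all the cubes \<open>E j\<close> below.\<close>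
  define g where "g = (\<lambda>y. ennreal (\<bar>v x - v y\<bar> powr p / norm (x - y) ^ ?N) * indicator {y. norm (x - y) < 1} y)"
  have "g = (\<lambda>y. if norm (x - y) < 1 then ennreal (\<bar>v x - v y\<bar> powr p / norm (x - y) ^ ?N) else 0)"
    unfolding g_def by (auto split: split_indicator)
  also have "\<dots> \<in> borel_measurable lebesgue" by measurable
  finally have g: "g \<in> borel_measurable lebesgue" .
  have gG: "(\<integral>\<^sup>+y\<in>\<Omega>. g y \<partial>lebesgue) = ?G"
    unfolding gagliardo_def g_def by (intro nn_integral_cong) (auto split: split_indicator)
  have one: "?F \<le> ennreal (2 powr p) * (ennreal ?c * (\<integral>\<^sup>+y\<in>E j. g y \<partial>lebesgue) + ?A j)"
    if j: "j \<in> {k<..j1}" for j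
  proof -
    have Ej: "E j \<in> W" "C1 * 2 powi j \<le> side_length (E j)" "\<And>y. y \<in> E j \<Longrightarrow> norm (x - y) < C3 * 2 powi j"
      using E[of j] j by auto
    note l = whitney_cube(2)[OF W Ej(1)]
    have pos: "side_length (E j) > 0" unfolding l by simp
    have "C3 * 2 powi j \<le> C3 * 2 powi j1"
      using j \<open>C3 > 0\<close> by (intro mult_left_mono power_int_increasing) auto
    then have lt1: "norm (x - y) < 1" if "y \<in> E j" for y
      using Ej(3)[OF that] C3 by linarith
    have "C3 * 2 powi j / side_length (E j) \<le> C3 * 2 powi j / (C1 * 2 powi j)"
      using Ej(2) \<open>C1 > 0\<close> \<open>C3 > 0\<close> pos by (intro divide_left_mono) auto
    then have "(C3 * 2 powi j / side_length (E j)) ^ ?N \<le> ?c"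
      using \<open>C3 > 0\<close> pos by (intro power_mono) auto
    moreover have "(\<integral>\<^sup>+y\<in>E j. ennreal (\<bar>v x - v y\<bar> powr p / norm (x - y) ^ ?N) \<partial>lebesgue)
        = (\<integral>\<^sup>+y\<in>E j. g y \<partial>lebesgue)"
      using lt1 unfolding g_def by (intro nn_integral_cong) (auto split: split_indicator)
    moreover have "is_cube (side_length (E j)) (E j)"
      using whitney_cube(1)[OF W Ej(1)] l by simp
    note pointwise_le_average[OF v \<open>p > 0\<close> this Ej(3) pos]
    ultimately have "?F \<le> ennreal (2 powr p) *
        (ennreal ((C3 * 2 powi j / side_length (E j)) ^ ?N) * (\<integral>\<^sup>+y\<in>E j. g y \<partial>lebesgue) + ?A j)"
      by simp
    also have "\<dots> \<le> ennreal (2 powr p) * (ennreal ?c * (\<integral>\<^sup>+y\<in>E j. g y \<partial>lebesgue) + ?A j)"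
      using \<open>(C3 * 2 powi j / side_length (E j)) ^ ?N \<le> ?c\<close>
      by (intro mult_left_mono add_right_mono mult_right_mono ennreal_leI) auto
    finally show ?thesis .
  qed
  have "max 0 (- real_of_int k) \<le> - real_of_int j1 + real (card {k<..j1})"
    using \<open>j1 \<le> 0\<close> by auto
  then have "?F * ennreal (max 0 (- real_of_int k)) \<le> ?F * ennreal (- real_of_int j1 + real (card {k<..j1}))"
    by (intro mult_left_mono ennreal_leI) auto
  also have "\<dots> = ennreal (- real_of_int j1) * ?F + of_nat (card {k<..j1}) * ?F"
    using \<open>j1 \<le> 0\<close>
    by (subst ennreal_plus) (simp_all add: ennreal_of_nat_eq_real_of_nat distrib_left mult.commute)
  also have "of_nat (card {k<..j1}) * ?F = (\<Sum>j\<in>{k<..j1}. ?F)"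
    by simp
  also have "\<dots> \<le> (\<Sum>j\<in>{k<..j1}. ennreal (2 powr p) * (ennreal ?c * (\<integral>\<^sup>+y\<in>E j. g y \<partial>lebesgue) + ?A j))"
    by (intro sum_mono one)
  also have "\<dots> = ennreal (2 powr p) * (ennreal ?c * (\<Sum>j\<in>{k<..j1}. \<integral>\<^sup>+y\<in>E j. g y \<partial>lebesgue) + (\<Sum>j\<in>{k<..j1}. ?A j))"
    by (simp only: sum_distrib_left[symmetric] sum.distrib)
  also have "\<dots> \<le> ennreal (2 powr p) * (ennreal ?c * (ennreal ?K * ?G) + (\<Sum>j\<in>{k<..j1}. ?A j))"
    unfolding gG[symmetric] using E \<open>C1 > 0\<close> \<open>C2 > 0\<close>
    by (intro mult_left_mono add_right_mono sum_integrals_scales_le[OF W g]) auto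
  also have "ennreal ?c * (ennreal ?K * ?G) = ennreal (?c * ?K) * ?G"
    using \<open>C1 > 0\<close> \<open>C3 > 0\<close> by (simp add: ennreal_mult mult.assoc del: ennreal_plus)
  finally show ?thesis
    by (simp add: add_left_mono)
qed

text \<open>Integration of \<open>scale_sum_estimate\<close> over \<open>\<Omega>\<close>, where the averages are summed by \<open>sum_averages_le\<close>. The constants
  depend on the geometric data and \<open>p\<close> only, which gives the uniformity in \<open>\<Omega>\<close>, the family of cubes and \<open>v\<close>.\<close>

lemma log_weighted_estimate:
  fixes v :: "real ^ 'n \<Rightarrow> real" and W :: "(real ^ 'n) set set"
    and E :: "(real ^ 'n) set \<Rightarrow> int \<Rightarrow> (real ^ 'n) set"
  assumes W: "whitney_decomposition \<Omega> W" and v[measurable]: "v \<in> borel_measurable lebesgue"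
    and "open \<Omega>" "\<Omega> \<noteq> UNIV" "p > 0" "C1 > 0" "C2 > 0" "C3 > 0" "C4 > 0" "j1 \<le> 0" "j1 \<le> j0"
    and lam: "lam < real CARD('n)"
    and C3: "C3 * 2 powi j1 \<le> 1"
    and E: "\<And>Q j. Q \<in> W \<Longrightarrow> level Q < j \<Longrightarrow> j \<le> j1 \<Longrightarrow> E Q j \<in> W \<and> C1 * 2 powi j \<le> side_length (E Q j) \<and>
      side_length (E Q j) \<le> C2 * 2 powi j \<and> (\<forall>x\<in>Q. \<forall>y\<in>E Q j. norm (x - y) < C3 * 2 powi j)"
    and fin: "\<And>n Q0 m. Q0 \<in> whitney_level W n \<Longrightarrow>
       finite {(Q, j). Q \<in> whitney_level W m \<and> m < j \<and> j \<le> j0 \<and> E Q j = Q0}"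
    and card: "\<And>n Q0 m. Q0 \<in> whitney_level W n \<Longrightarrow>
       real (card {(Q, j). Q \<in> whitney_level W m \<and> m < j \<and> j \<le> j0 \<and> E Q j = Q0})
         \<le> C4 * 2 powr (lam * real_of_int (n - m))"
  defines "A \<equiv> (C3 / C1) ^ CARD('n) * (1 + \<bar>log 2 (C2 / C1)\<bar>)"
    and "B \<equiv> C4 * (2 powr ((real CARD('n) - lam) * real_of_int \<lceil>- log 2 C1\<rceil>) / (1 - 2 powr (lam - real CARD('n))))"
  shows "(\<integral>\<^sup>+x\<in>\<Omega>. ennreal (\<bar>v x\<bar> powr p * ln_plus (1 / infdist x (frontier \<Omega>))) \<partial>lebesgue)
    \<le> ennreal (ln 2 * (- real_of_int j1 + 2 powr p * (A + B))) *
      ((\<integral>\<^sup>+x\<in>\<Omega>. gagliardo p \<Omega> v x \<partial>lebesgue) + (\<integral>\<^sup>+x\<in>\<Omega>. ennreal (\<bar>v x\<bar> powr p) \<partial>lebesgue))"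
proof -
  let ?N = "CARD('n)"
  define F where "F = (\<lambda>x. ennreal (\<bar>v x\<bar> powr p))"
  have F[measurable]: "F \<in> borel_measurable lebesgue" unfolding F_def by measurable
  define G where "G = gagliardo p \<Omega> v"
  have G[measurable]: "G \<in> borel_measurable lebesgue"
    unfolding G_def by (rule measurable_gagliardo[OF v \<open>open \<Omega>\<close>])
  have \<Omega>[measurable]: "\<Omega> \<in> sets lebesgue" using \<open>open \<Omega>\<close> by simp
  have Q[measurable]: "Q \<in> sets lebesgue" if "Q \<in> W" for Q
    by (rule whitney_cube(4)[OF W that])
  define S where "S = (\<lambda>Q. \<Sum>j\<in>{level Q<..j1}. ennreal (1 / side_length (E Q j) ^ ?N) * (\<integral>\<^sup>+y\<in>E Q j. F y \<partial>lebesgue))"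
  \<comment> \<open>A point on common boundaries of cubes receives several summands, which only increases the bound; so for a point \<open>x\<close> any cube containing it may be used.\<close>
  define H where "H = (\<lambda>x. \<integral>\<^sup>+Q. S Q * indicator Q x \<partial>count_space W)"
  have cW: "countable W" by (rule whitney_countable[OF W])
  have H[measurable]: "H \<in> borel_measurable lebesgue"
  proof -
    interpret sigma_finite_measure "count_space W"
      by (rule sigma_finite_measure_count_space_countable[OF cW])
    have "(\<lambda>(Q, x). S Q * indicator Q x) \<in> borel_measurable (count_space W \<Otimes>\<^sub>M lebesgue)"
      by (rule measurable_pair_measure_countable1[OF cW]) simp
    from measurable_pair_swap[OF this] show ?thesis
      unfolding H_def by (intro borel_measurable_nn_integral) simp
  qed
  have "A \<ge> 0" using \<open>C1 > 0\<close> \<open>C3 > 0\<close> unfolding A_def by simp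
  have "2 powr (lam - real ?N) < 1" using lam by (simp add: powr_less_one)
  then have "B \<ge> 0" using \<open>C4 > 0\<close> unfolding B_def by simp
  define t where "t = - real_of_int j1"
  have "t \<ge> 0" using \<open>j1 \<le> 0\<close> by (simp add: t_def)
  have H_le: "(\<integral>\<^sup>+x. H x \<partial>lebesgue) \<le> ennreal B * (\<integral>\<^sup>+x\<in>\<Omega>. F x \<partial>lebesgue)"
  proof -
    have "(\<integral>\<^sup>+x. H x \<partial>lebesgue) = (\<integral>\<^sup>+Q. \<integral>\<^sup>+x. S Q * indicator Q x \<partial>lebesgue \<partial>count_space W)"
      unfolding H_def by (rule nn_integral_count_space_nn_integral[OF cW]) measurable
    also have "\<dots> = (\<integral>\<^sup>+Q. (\<Sum>j\<in>{level Q<..j1}. emeasure lebesgue Q *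
        (ennreal (1 / side_length (E Q j) ^ ?N) * (\<integral>\<^sup>+y\<in>E Q j. F y \<partial>lebesgue))) \<partial>count_space W)"
      using Q by (intro nn_integral_cong) (simp add: nn_integral_cmult_indicator S_def sum_distrib_left mult.commute[of _ "emeasure _ _"])
    also have "\<dots> \<le> ennreal B * (\<integral>\<^sup>+x\<in>\<Omega>. F x \<partial>lebesgue)"
      unfolding B_def using E fin card
      by (intro sum_averages_le[OF W F \<open>C1 > 0\<close> \<open>C4 > 0\<close> lam \<open>j1 \<le> j0\<close>]) blast+
    finally show ?thesis .
  qed
  have pt: "ennreal (\<bar>v x\<bar> powr p * ln_plus (1 / infdist x (frontier \<Omega>)))
      \<le> ennreal (ln 2) * (ennreal t * F x + ennreal (2 powr p) * (ennreal A * G x + H x))"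
    if "x \<in> \<Omega>" for x
  proof -
    obtain Q where Qx: "Q \<in> W" "x \<in> Q"
      using \<open>x \<in> \<Omega>\<close> W unfolding whitney_decomposition_def by blast
    have "S Q = S Q * indicator Q x" using Qx by simp
    also have "\<dots> \<le> H x"
      unfolding H_def by (rule nn_integral_ge_point[OF Qx(1)])
    finally have SH: "S Q \<le> H x" .
    have "ennreal (\<bar>v x\<bar> powr p * ln_plus (1 / infdist x (frontier \<Omega>)))
        \<le> ennreal (\<bar>v x\<bar> powr p * (ln 2 * max 0 (- real_of_int (level Q))))"
      by (intro ennreal_leI mult_left_mono ln_plus_inverse_dist_le[OF W Qx \<open>\<Omega> \<noteq> UNIV\<close>]) simp
    also have "\<dots> = ennreal (ln 2) * (F x * ennreal (max 0 (- real_of_int (level Q))))"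
      unfolding F_def by (simp add: ennreal_mult mult_ac)
    also have "\<dots> \<le> ennreal (ln 2) * (ennreal t * F x + ennreal (2 powr p) * (ennreal A * G x + S Q))"
      unfolding F_def G_def S_def A_def t_def
      using E[OF Qx(1)] Qx(2)
      by (intro mult_left_mono scale_sum_estimate[OF W v \<open>open \<Omega>\<close> \<open>p > 0\<close> \<open>C1 > 0\<close> \<open>C2 > 0\<close> \<open>C3 > 0\<close> \<open>j1 \<le> 0\<close> C3]) auto
    also have "\<dots> \<le> ennreal (ln 2) * (ennreal t * F x + ennreal (2 powr p) * (ennreal A * G x + H x))"
      using SH by (intro mult_left_mono add_left_mono) auto
    finally show ?thesis .
  qed
  let ?IF = "\<integral>\<^sup>+x\<in>\<Omega>. F x \<partial>lebesgue" and ?IG = "\<integral>\<^sup>+x\<in>\<Omega>. G x \<partial>lebesgue"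
  have "(\<integral>\<^sup>+x\<in>\<Omega>. ennreal (\<bar>v x\<bar> powr p * ln_plus (1 / infdist x (frontier \<Omega>))) \<partial>lebesgue)
      \<le> (\<integral>\<^sup>+x. ennreal (ln 2) * (ennreal t * (F x * indicator \<Omega> x) +
          ennreal (2 powr p) * (ennreal A * (G x * indicator \<Omega> x) + H x)) \<partial>lebesgue)"
    using pt by (intro nn_integral_mono) (auto split: split_indicator)
  also have "\<dots> = ennreal (ln 2) * (ennreal t * ?IF + ennreal (2 powr p) * (ennreal A * ?IG + (\<integral>\<^sup>+x. H x \<partial>lebesgue)))"
    by (simp add: nn_integral_cmult nn_integral_add)
  also have "\<dots> \<le> ennreal (ln 2) * (ennreal t * (?IG + ?IF) + ennreal (2 powr p) * (ennreal A * (?IG + ?IF) + ennreal B * (?IG + ?IF)))"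
    using order_trans[OF H_le mult_left_mono[of ?IF "?IG + ?IF" "ennreal B"]]
    by (intro mult_left_mono add_mono) auto
  also have "\<dots> = ennreal (ln 2 * (t + 2 powr p * (A + B))) * (?IG + ?IF)"
    using \<open>t \<ge> 0\<close> \<open>A \<ge> 0\<close> \<open>B \<ge> 0\<close>
    by (simp only: ennreal_mult ennreal_plus add_nonneg_nonneg mult_nonneg_nonneg powr_ge_zero ln_ge_zero
        one_le_numeral distrib_left distrib_right mult.assoc add_ac)
  finally show ?thesis
    unfolding F_def G_def t_def .
qed

theorem theorem5p1:
  fixes C1 C2 C3 C4 lam p :: real and j0 :: int
  assumes "0 < C1" "0 < C2" "0 < C3" "0 < C4"
    and "j0 \<le> 0"
    and "lam < real CARD('n::finite)"
    and "0 < p"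
  shows "\<exists>c>0. \<forall>(\<Omega> :: (real ^ 'n) set) W (E :: (real ^ 'n) set \<Rightarrow> int \<Rightarrow> (real ^ 'n) set).
    open \<Omega> \<and> \<Omega> \<noteq> {} \<and> \<Omega> \<noteq> UNIV \<and> whitney_decomposition \<Omega> W \<and>
    (\<forall>k Q j. k < j0 \<and> Q \<in> whitney_level W k \<and> k < j \<and> j \<le> j0 \<longrightarrow>
       E Q j \<in> W \<and>
       C1 * 2 powi j \<le> side_length (E Q j) \<and> side_length (E Q j) \<le> C2 * 2 powi j \<and>
       (\<forall>x\<in>Q. \<forall>y\<in>E Q j. norm (x - y) < C3 * 2 powi j)) \<and>
    (\<forall>n. \<forall>Q0\<in>whitney_level W n. \<forall>m.
       finite {(Q, j). Q \<in> whitney_level W m \<and> m < j \<and> j \<le> j0 \<and> E Q j = Q0} \<and>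
       real (card {(Q, j). Q \<in> whitney_level W m \<and> m < j \<and> j \<le> j0 \<and> E Q j = Q0})
         \<le> C4 * 2 powr (lam * real_of_int (n - m)))
    \<longrightarrow> (\<forall>u\<in>Lp_on p \<Omega>.
      (\<integral>\<^sup>+ x. ennreal (\<bar>u x\<bar> powr p * ln_plus (1 / infdist x (frontier \<Omega>))) \<partial>lebesgue_on \<Omega>)
      \<le> ennreal c *
         ((\<integral>\<^sup>+ x. (\<integral>\<^sup>+ y. ennreal (\<bar>u x - u y\<bar> powr p / norm (x - y) ^ CARD('n))
              \<partial>lebesgue_on {y \<in> \<Omega>. norm (x - y) < 1}) \<partial>lebesgue_on \<Omega>)
          + (\<integral>\<^sup>+ x. ennreal (\<bar>u x\<bar> powr p) \<partial>lebesgue_on \<Omega>)))"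
proof -
  let ?N = "CARD('n)"
  \<comment> \<open>The truncation makes \<open>norm (x - y) < 1\<close> for \<open>x \<in> Q\<close>, \<open>y \<in> E Q j\<close> and \<open>j \<le> j1\<close>; the finitely many scales between \<open>j1\<close> and \<open>0\<close> only cost a multiple of the \<open>L\<^sup>p\<close> term.\<close>
  define j1 where "j1 = min j0 \<lfloor>- log 2 C3\<rfloor>"
  have "j1 \<le> j0" "j1 \<le> 0" using \<open>j0 \<le> 0\<close> unfolding j1_def by auto
  have C3: "C3 * 2 powi j1 \<le> 1"
  proof -
    have "real_of_int j1 \<le> log 2 (1 / C3)"
      unfolding j1_def using \<open>0 < C3\<close> by (simp add: log_divide) linarith
    then have "2 powr real_of_int j1 \<le> 1 / C3"
      using \<open>0 < C3\<close> by (subst (asm) le_log_iff) auto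
    then show ?thesis
      using \<open>0 < C3\<close> by (simp add: powr_real_of_int' field_simps)
  qed
  define A where "A = (C3 / C1) ^ ?N * (1 + \<bar>log 2 (C2 / C1)\<bar>)"
  define B where "B = C4 * (2 powr ((real ?N - lam) * real_of_int \<lceil>- log 2 C1\<rceil>) / (1 - 2 powr (lam - real ?N)))"
  define c where "c = ln 2 * (- real_of_int j1 + 2 powr p * (A + B))"
  have "A > 0" unfolding A_def using assms by (intro mult_pos_pos) auto
  have "2 powr (lam - real ?N) < 1" using assms by (simp add: powr_less_one)
  then have "B > 0" using assms unfolding B_def by simp
  have "c > 0"
    unfolding c_def using \<open>A > 0\<close> \<open>B > 0\<close> \<open>j1 \<le> 0\<close> by (intro mult_pos_pos add_nonneg_pos) auto
  show ?thesis
  proof (intro exI[of _ c] conjI \<open>c > 0\<close> allI impI ballI, elim conjE)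
    fix \<Omega> :: "(real ^ 'n) set" and W E u
    assume \<Omega>: "open \<Omega>" "\<Omega> \<noteq> UNIV" and W: "whitney_decomposition \<Omega> W" and u: "u \<in> Lp_on p \<Omega>"
      and E: "\<forall>k Q j. k < j0 \<and> Q \<in> whitney_level W k \<and> k < j \<and> j \<le> j0 \<longrightarrow>
       E Q j \<in> W \<and>
       C1 * 2 powi j \<le> side_length (E Q j) \<and> side_length (E Q j) \<le> C2 * 2 powi j \<and>
       (\<forall>x\<in>Q. \<forall>y\<in>E Q j. norm (x - y) < C3 * 2 powi j)"
      and count: "\<forall>n. \<forall>Q0\<in>whitney_level W n. \<forall>m.
       finite {(Q, j). Q \<in> whitney_level W m \<and> m < j \<and> j \<le> j0 \<and> E Q j = Q0} \<and>
       real (card {(Q, j). Q \<in> whitney_level W m \<and> m < j \<and> j \<le> j0 \<and> E Q j = Q0})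
         \<le> C4 * 2 powr (lam * real_of_int (n - m))"
    define v where "v = (\<lambda>x. if x \<in> \<Omega> then u x else 0)"
    have [simp]: "\<Omega> \<in> sets lebesgue" using \<Omega>(1) by simp
    have v: "v \<in> borel_measurable lebesgue"
      using u unfolding v_def Lp_on_def by (simp add: borel_measurable_if)
    have E': "E Q j \<in> W \<and> C1 * 2 powi j \<le> side_length (E Q j) \<and>
        side_length (E Q j) \<le> C2 * 2 powi j \<and> (\<forall>x\<in>Q. \<forall>y\<in>E Q j. norm (x - y) < C3 * 2 powi j)"
      if "Q \<in> W" "level Q < j" "j \<le> j1" for Q j
    proof -
      have "Q \<in> whitney_level W (level Q)"
        using whitney_cube(2)[OF W that(1)] that(1) unfolding whitney_level_def by simp
      moreover have "level Q < j0" "j \<le> j0" using that \<open>j1 \<le> j0\<close> by auto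
      ultimately show ?thesis using E that(2) by blast
    qed
    have main: "(\<integral>\<^sup>+x\<in>\<Omega>. ennreal (\<bar>v x\<bar> powr p * ln_plus (1 / infdist x (frontier \<Omega>))) \<partial>lebesgue)
      \<le> ennreal c * ((\<integral>\<^sup>+x\<in>\<Omega>. gagliardo p \<Omega> v x \<partial>lebesgue) + (\<integral>\<^sup>+x\<in>\<Omega>. ennreal (\<bar>v x\<bar> powr p) \<partial>lebesgue))"
      unfolding c_def A_def B_def
      by (rule log_weighted_estimate[OF W v \<Omega> \<open>0 < p\<close> \<open>0 < C1\<close> \<open>0 < C2\<close> \<open>0 < C3\<close> \<open>0 < C4\<close> \<open>j1 \<le> 0\<close>
          \<open>j1 \<le> j0\<close> \<open>lam < real ?N\<close> C3 E']) (use count in blast)+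
    have restrict: "(\<integral>\<^sup>+x. f x \<partial>lebesgue_on \<Omega>) = (\<integral>\<^sup>+x\<in>\<Omega>. h x \<partial>lebesgue)"
      if "\<And>x. x \<in> \<Omega> \<Longrightarrow> f x = h x" for f h :: "real ^ 'n \<Rightarrow> ennreal"
      using that by (auto simp: nn_integral_restrict_space intro!: nn_integral_cong split: split_indicator)
    have inner: "(\<integral>\<^sup>+ y. ennreal (\<bar>u x - u y\<bar> powr p / norm (x - y) ^ ?N) \<partial>lebesgue_on {y \<in> \<Omega>. norm (x - y) < 1})
        = gagliardo p \<Omega> v x" if "x \<in> \<Omega>" for x
    proof -
      have "{y \<in> \<Omega>. norm (x - y) < 1} = \<Omega> \<inter> ball x 1"
        by (auto simp: dist_norm)
      then have "{y \<in> \<Omega>. norm (x - y) < 1} \<in> sets lebesgue"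
        using \<Omega>(1) by auto
      then show ?thesis
        unfolding gagliardo_def v_def using that
        by (auto simp: nn_integral_restrict_space intro!: nn_integral_cong split: split_indicator)
    qed
    show "(\<integral>\<^sup>+ x. ennreal (\<bar>u x\<bar> powr p * ln_plus (1 / infdist x (frontier \<Omega>))) \<partial>lebesgue_on \<Omega>)
      \<le> ennreal c *
         ((\<integral>\<^sup>+ x. (\<integral>\<^sup>+ y. ennreal (\<bar>u x - u y\<bar> powr p / norm (x - y) ^ ?N)
              \<partial>lebesgue_on {y \<in> \<Omega>. norm (x - y) < 1}) \<partial>lebesgue_on \<Omega>)
          + (\<integral>\<^sup>+ x. ennreal (\<bar>u x\<bar> powr p) \<partial>lebesgue_on \<Omega>))"
      using main inner
      by (simp add: restrict[of _ "\<lambda>x. ennreal (\<bar>v x\<bar> powr p * ln_plus (1 / infdist x (frontier \<Omega>)))"]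
          restrict[of _ "gagliardo p \<Omega> v"] restrict[of _ "\<lambda>x. ennreal (\<bar>v x\<bar> powr p)"] v_def)
  qed
qed

end
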